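(* Let $\ell \geq 1$ be an integer. There exists an algorithm that, given as input a graph $G$ together with a good partition $(L,H,R)$ of $V(G)$ and a partition $(I,O)$ of $H \cup R$, runs in polynomial time and outputs a graph $G'$ with $V(G)\cap V(G') \supseteq L$, an excellent partition $(L,H',R')$ of $V(G')$, and a partition $(I',O')$ of $H' \cup R'$, with the following property: for every set $S \subseteq L$, $S$ is a minimal $(I,O)$-extension in $G$ if and only if $S$ is a minimal $(I',O')$-extension in $G'$.
   Context: All graphs are finite and simple. For the fixed integer $\ell$, a partition $(L,H,R)$ of the vertex set of a graph into three sets is a good partition if $|L| \geq 10|H|$, $L$ is an independent set, and every vertex of $L$ has fewer than $\ell$ neighbors in $R$. A good partition $(L,H,R)$ is an excellent partition if moreover the induced subgraph on $H \cup R$ has no edges. A vertex set $X$ is a connected dominating set of a graph if every vertex not in $X$ has a neighbor in $X$ and the subgraph induced by $X$ is connected. For disjoint vertex sets $I$ and $O$, an $(I,O)$-extension is a vertex set $S$ disjoint from $I \cup O$ such that $I \cup S$ is a connected dominating set; it is minimal if no proper subset of it is also an $(I,O)$-extension. *)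

theory Defs
  imports
    "HOL-Computational_Algebra.Polynomial"
    "Graph_Theory.Digraph_Component"
begin

section \<open>Graphs, partitions and extensions\<close>

text \<open>
  Finite simple graphs are the \<^emph>\<open>pair_graph\<close>s of the library: finite, loop-free, symmetric
  sets of pairs. The parts of a partition may be empty.
\<close>

definition bipartition_of :: "'a set \<Rightarrow> 'a set \<Rightarrow> 'a set \<Rightarrow> bool" where
  "bipartition_of A X Y \<longleftrightarrow> X \<union> Y = A \<and> X \<inter> Y = {}"

definition tripartition_of :: "'a set \<Rightarrow> 'a set \<Rightarrow> 'a set \<Rightarrow> 'a set \<Rightarrow> bool" where
  "tripartition_of A X Y Z \<longleftrightarrow>
     X \<union> Y \<union> Z = A \<and> X \<inter> Y = {} \<and> X \<inter> Z = {} \<and> Y \<inter> Z = {}"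

definition edgeless_on :: "'a pair_pre_digraph \<Rightarrow> 'a set \<Rightarrow> bool" where
  "edgeless_on G X \<longleftrightarrow> arcs (with_proj G \<restriction> X) = {}"

definition good_partition ::
    "nat \<Rightarrow> 'a pair_pre_digraph \<Rightarrow> 'a set \<Rightarrow> 'a set \<Rightarrow> 'a set \<Rightarrow> bool" where
  "good_partition l G L H R \<longleftrightarrow>
     tripartition_of (pverts G) L H R \<and>
     card L \<ge> 10 * card H \<and>
     edgeless_on G L \<and>
     (\<forall>v\<in>L. card {r \<in> R. (v, r) \<in> parcs G} < l)"

definition excellent_partition ::
    "nat \<Rightarrow> 'a pair_pre_digraph \<Rightarrow> 'a set \<Rightarrow> 'a set \<Rightarrow> 'a set \<Rightarrow> bool" where
  "excellent_partition l G L H R \<longleftrightarrow> good_partition l G L H R \<and> edgeless_on G (H \<union> R)"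

text \<open>\<^emph>\<open>connected\<close> is qualified because the topological notion has the same base name.\<close>

definition connected_dominating_set :: "'a pair_pre_digraph \<Rightarrow> 'a set \<Rightarrow> bool" where
  "connected_dominating_set G X \<longleftrightarrow>
     X \<subseteq> pverts G \<and>
     (\<forall>v \<in> pverts G - X. \<exists>u\<in>X. (v, u) \<in> parcs G) \<and>
     Digraph_Component.connected (with_proj G \<restriction> X)"

definition extension :: "'a pair_pre_digraph \<Rightarrow> 'a set \<Rightarrow> 'a set \<Rightarrow> 'a set \<Rightarrow> bool" where
  "extension G In Out S \<longleftrightarrow>
     S \<subseteq> pverts G \<and> S \<inter> (In \<union> Out) = {} \<and> connected_dominating_set G (In \<union> S)"

definition minimal_extension ::
    "'a pair_pre_digraph \<Rightarrow> 'a set \<Rightarrow> 'a set \<Rightarrow> 'a set \<Rightarrow> bool" where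
  "minimal_extension G In Out S \<longleftrightarrow>
     extension G In Out S \<and> (\<forall>T. T \<subset> S \<longrightarrow> \<not> extension G In Out T)"


section \<open>The model of computation\<close>

text \<open>
  Algorithms are programs of Neil Jones's WHILE language (\<^emph>\<open>Computability and Complexity\<close>, 1997):
  finitely many variables hold binary trees, which can be built, taken apart and compared; a
  condition is true iff its value is not \<open>Leaf\<close>. Every expression node is charged one unit plus
  the size (number of \<open>Node\<close>s) of its value. Hence the time bounds the size of everything that
  is written, and the model is polynomially equivalent to Turing machines; under unit cost, sharing would
  allow trees of exponential size.
\<close>

datatype data = Leaf | Node data data

datatype expr = Var nat | NilE | ConsE expr expr | Hd expr | Tl expr | Eq expr expr

datatype com = Skip | Assign nat expr | Seq com com | Cond expr com com | While expr com

type_synonym store = "nat \<Rightarrow> data"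

fun hd_data :: "data \<Rightarrow> data" where
  "hd_data Leaf = Leaf"
| "hd_data (Node a b) = a"

fun tl_data :: "data \<Rightarrow> data" where
  "tl_data Leaf = Leaf"
| "tl_data (Node a b) = b"

primrec val :: "expr \<Rightarrow> store \<Rightarrow> data" where
  "val (Var x) s = s x"
| "val NilE s = Leaf"
| "val (ConsE e f) s = Node (val e s) (val f s)"
| "val (Hd e) s = hd_data (val e s)"
| "val (Tl e) s = tl_data (val e s)"
| "val (Eq e f) s = (if val e s = val f s then Node Leaf Leaf else Leaf)"

primrec cost :: "expr \<Rightarrow> store \<Rightarrow> nat" where
  "cost (Var x) s = 1 + size (s x)"
| "cost NilE s = 1"
| "cost (ConsE e f) s = cost e s + cost f s + 1 + size (val (ConsE e f) s)"
| "cost (Hd e) s = cost e s + 1 + size (val (Hd e) s)"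
| "cost (Tl e) s = cost e s + 1 + size (val (Tl e) s)"
| "cost (Eq e f) s = cost e s + cost f s + 1 + size (val (Eq e f) s)"

text \<open>\<open>exec c s t s'\<close>: from store \<open>s\<close>, command \<open>c\<close> halts after time \<open>t\<close> in store \<open>s'\<close>.\<close>

inductive exec :: "com \<Rightarrow> store \<Rightarrow> nat \<Rightarrow> store \<Rightarrow> bool" where
  Skip: "exec Skip s 1 s"
| Assign: "exec (Assign x e) s (1 + cost e s) (s(x := val e s))"
| Seq: "exec c s t s' \<Longrightarrow> exec d s' u s'' \<Longrightarrow> exec (Seq c d) s (1 + t + u) s''"
| CondTrue: "val e s \<noteq> Leaf \<Longrightarrow> exec c s t s' \<Longrightarrow> exec (Cond e c d) s (1 + cost e s + t) s'"
| CondFalse: "val e s = Leaf \<Longrightarrow> exec d s t s' \<Longrightarrow> exec (Cond e c d) s (1 + cost e s + t) s'"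
| WhileFalse: "val e s = Leaf \<Longrightarrow> exec (While e c) s (1 + cost e s) s"
| WhileTrue: "val e s \<noteq> Leaf \<Longrightarrow> exec c s t s' \<Longrightarrow> exec (While e c) s' u s'' \<Longrightarrow>
    exec (While e c) s (1 + cost e s + t + u) s''"

lemma exec_deterministic:
  "exec c s t s' \<Longrightarrow> exec c s u s'' \<Longrightarrow> t = u \<and> s' = s''"
proof (induction arbitrary: u s'' rule: exec.induct)
  case (Seq c s t s' d v s3)
  from Seq.prems show ?case
    by (cases rule: exec.cases) (use Seq.IH in blast)+
next
  case (WhileTrue e s c t s' v s3)
  from WhileTrue.prems show ?case
    by (cases rule: exec.cases) (use WhileTrue.IH WhileTrue.hyps in blast)+
qed (erule exec.cases; blast)+

text \<open>Input and output are passed in variable 0; all other variables start as \<open>Leaf\<close>.\<close>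

definition computes :: "com \<Rightarrow> data \<Rightarrow> nat \<Rightarrow> data \<Rightarrow> bool" where
  "computes c x t y \<longleftrightarrow> (\<exists>s. exec c ((\<lambda>_. Leaf)(0 := x)) t s \<and> s 0 = y)"


section \<open>Encoding of instances\<close>

text \<open>Vertices are natural numbers, written in binary with the least significant bit first.\<close>

fun enc_nat :: "nat \<Rightarrow> data" where
  "enc_nat n = (if n = 0 then Leaf
     else Node (if odd n then Node Leaf Leaf else Leaf) (enc_nat (n div 2)))"

declare enc_nat.simps [simp del]

definition enc_arc :: "nat \<times> nat \<Rightarrow> data" where
  "enc_arc a = Node (enc_nat (fst a)) (enc_nat (snd a))"

fun enc_list :: "('a \<Rightarrow> data) \<Rightarrow> 'a list \<Rightarrow> data" where
  "enc_list f [] = Leaf"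
| "enc_list f (a # as) = Node (f a) (enc_list f as)"

text \<open>
  A set is encoded by any list of its elements, in arbitrary order and possibly with repetitions;
  so an instance has many encodings, but an encoding belongs to only one instance.
  Every edge is listed in both directions, as in adjacency lists.
\<close>

definition encodes_instance ::
    "data \<Rightarrow> nat pair_pre_digraph \<Rightarrow> nat set \<Rightarrow> nat set \<Rightarrow> nat set \<Rightarrow> nat set \<Rightarrow> nat set \<Rightarrow> bool" where
  "encodes_instance x G L H R In Out \<longleftrightarrow>
     (\<exists>vs as ls hs rs is os.
        set vs = pverts G \<and> set as = parcs G \<and>
        set ls = L \<and> set hs = H \<and> set rs = R \<and> set is = In \<and> set os = Out \<and>
        x = enc_list id
          [enc_list enc_nat vs, enc_list enc_arc as,
           enc_list enc_nat ls, enc_list enc_nat hs, enc_list enc_nat rs,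
           enc_list enc_nat is, enc_list enc_nat os])"

lemma enc_nat_inject: "enc_nat m = enc_nat n \<Longrightarrow> m = n"
proof (induction m arbitrary: n rule: less_induct)
  case (less m)
  show ?case
  proof (cases "m = 0 \<or> n = 0")
    case True
    then show ?thesis
      using less.prems
      by (auto simp: enc_nat.simps[of m] enc_nat.simps[of n] enc_nat.simps[of 0] split: if_splits)
  next
    case False
    then have "enc_nat (m div 2) = enc_nat (n div 2)" and "odd m = odd n"
      using less.prems
      by (auto simp: enc_nat.simps[of m] enc_nat.simps[of n] split: if_splits)
    moreover from this have "m div 2 = n div 2"
      using less.IH[of "m div 2"] False by simp
    ultimately show ?thesis
      by (metis bit_eq_rec)
  qed
qed

lemma enc_list_inject: "inj f \<Longrightarrow> enc_list f xs = enc_list f ys \<Longrightarrow> xs = ys"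
proof (induction xs arbitrary: ys)
  case Nil
  then show ?case by (cases ys) auto
next
  case (Cons a xs)
  then show ?case by (cases ys) (auto dest: injD)
qed

lemma encodes_instance_unique:
  assumes "encodes_instance x G L H R In Out" and "encodes_instance x G' L' H' R' In' Out'"
  shows "G = G' \<and> L = L' \<and> H = H' \<and> R = R' \<and> In = In' \<and> Out = Out'"
proof -
  have i: "inj enc_nat" "inj enc_arc"
    by (auto simp: inj_def enc_arc_def dest: enc_nat_inject)
  have "enc_list enc_nat as = enc_list enc_nat bs \<longleftrightarrow> as = bs" for as bs
    using enc_list_inject[OF i(1)] by blast
  moreover have "enc_list enc_arc as = enc_list enc_arc bs \<longleftrightarrow> as = bs" for as bs
    using enc_list_inject[OF i(2)] by blast
  ultimately show ?thesis
    using assms unfolding encodes_instance_def by (auto intro!: pair_pre_digraph.equality)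
qed

end

theory Submission
  imports Defs
begin

text \<open>
  Contract every connected component of \<open>G[In]\<close> to one of its vertices, delete the set \<open>D\<close> of those
  vertices of \<open>Out\<close> that already have a neighbour in \<open>In\<close>, and drop all edges that do not meet \<open>L\<close>.
  A contracted component is put into \<open>H'\<close> iff it contains a vertex of \<open>H\<close>; so \<open>H\<close> does not grow, and
  distinct neighbours in \<open>R'\<close> of a vertex of \<open>L\<close> come from distinct neighbours in \<open>R\<close>. Because
  extensions are subsets of the independent set \<open>L\<close>, neither connectedness nor domination changes.

  Running time is handled by a class of polynomial-time functions between encodable types that is
  closed under composition, pairing, conditionals and folds over lists whose accumulator stays
  polynomially bounded.
\<close>

section \<open>Contracting the components of the prescribed set\<close>

text \<open>The library defines connectedness through the symmetric closure and
  \<open>rtrancl_on\<close>. Symmetric arcs make the closure redundant, and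
  \<open>rtrancl_on\<close> differs from the ordinary closure only in requiring the start vertex to
  lie in \<open>X\<close>.\<close>

lemma connected_induce_iff:
  assumes "sym (parcs G)"
  shows "Digraph_Component.connected (with_proj G \<restriction> X) \<longleftrightarrow>
    X \<noteq> {} \<and> (\<forall>u\<in>X. \<forall>v\<in>X. (u, v) \<in> (parcs G \<inter> X \<times> X)\<^sup>*)"
proof -
  let ?E = "parcs G \<inter> X \<times> X"
  have arcs: "parcs (mk_symmetric (with_proj G \<restriction> X)) = ?E"
    using assms by (auto simp: parcs_mk_symmetric dest: symD)
  have "(u, v) \<in> rtrancl_on X ?E \<longleftrightarrow> (u, v) \<in> ?E\<^sup>*" if "u \<in> X" for u v
  proof
    assume "(u, v) \<in> ?E\<^sup>*"
    then show "(u, v) \<in> rtrancl_on X ?E"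
      using that by induction (auto intro: rtrancl_on_into_rtrancl_on)
  qed (rule rtrancl_on_rtranclI)
  then show ?thesis
    by (auto simp: Digraph_Component.connected_def strongly_connected_def reachable_def arcs)
qed

lemma edgeless_on_iff: "edgeless_on G X \<longleftrightarrow> (\<forall>u\<in>X. \<forall>v\<in>X. (u, v) \<notin> parcs G)"
  by (auto simp: edgeless_on_def)

text \<open>\<open>f\<close> is an abstract choice of representatives: \<open>f_path\<close> places
  \<open>f v\<close> in the component of \<open>v\<close> in \<open>G[In]\<close>, and
  \<open>f_arc\<close> makes \<open>f\<close> constant on each component. Hence two vertices of
  \<open>In\<close> have the same image iff they lie in one component. The computed labels
  instantiate \<open>f\<close> later.\<close>

locale contraction =
  fixes l :: nat and G :: "'a pair_pre_digraph" and L H R In Out and f :: "'a \<Rightarrow> 'a"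
  assumes graph: "pair_graph G"
    and good: "good_partition l G L H R"
    and prescribed: "bipartition_of (H \<union> R) In Out"
    and f_outside: "v \<notin> In \<Longrightarrow> f v = v"
    and f_In: "v \<in> In \<Longrightarrow> f v \<in> In"
    and f_path: "v \<in> In \<Longrightarrow> (v, f v) \<in> (parcs G \<inter> In \<times> In)\<^sup>*"
    and f_arc: "(u, v) \<in> parcs G \<Longrightarrow> u \<in> In \<Longrightarrow> v \<in> In \<Longrightarrow> f u = f v"
begin

text \<open>These vertices are dominated by \<open>In \<union> S\<close> for every \<open>S\<close>,
  so they constrain nothing. They must be deleted because \<open>G'\<close> drops the edges between
  \<open>Out\<close> and \<open>In\<close> that dominate them.\<close>

definition D :: "'a set" where
  "D = {x \<in> Out. \<exists>y\<in>In. (x, y) \<in> parcs G}"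

definition G' :: "'a pair_pre_digraph" where
  "G' = \<lparr>pverts = f ` pverts G - D,
    parcs = map_prod f f ` {(x, y) \<in> parcs G. (x \<in> L \<or> y \<in> L) \<and> x \<notin> D \<and> y \<notin> D}\<rparr>"

lemma arcs_sym: "(u, v) \<in> parcs G \<Longrightarrow> (v, u) \<in> parcs G"
  by (rule pair_sym_digraph.arcs_symmetric[OF pair_pseudo_graph.axioms(2)[OF pair_graph.axioms(2)[OF graph]]])

lemma arcs_verts: "(u, v) \<in> parcs G \<Longrightarrow> u \<in> pverts G \<and> v \<in> pverts G"
  using pair_graph.axioms(1)[OF graph] pair_wf_digraph.in_arcsD1 pair_wf_digraph.in_arcsD2
  by (metis pair_digraph.axioms(1) pair_fin_digraph.axioms(1))

lemma finite_verts: "finite (pverts G)"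
  using pair_graph.axioms(1)[OF graph] by (meson pair_digraph_def pair_fin_digraph.pair_finite_verts)

lemma finite_arcs: "finite (parcs G)"
  using pair_graph.axioms(1)[OF graph] by (meson pair_digraph_def pair_fin_digraph.pair_finite_arcs)

lemma parts:
  "pverts G = L \<union> In \<union> Out" "In \<inter> Out = {}" "L \<inter> In = {}" "L \<inter> Out = {}"
  using good prescribed by (auto simp: good_partition_def tripartition_of_def bipartition_of_def)

lemma HR: "pverts G = L \<union> H \<union> R" "H \<union> R = In \<union> Out" "L \<inter> (H \<union> R) = {}"
  using good prescribed by (auto simp: good_partition_def tripartition_of_def bipartition_of_def)

lemma L_independent: "u \<in> L \<Longrightarrow> v \<in> L \<Longrightarrow> (u, v) \<notin> parcs G"
  using good by (auto simp: good_partition_def edgeless_on_iff)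

lemma f_id [simp]: "v \<in> L \<Longrightarrow> f v = v" "v \<in> Out \<Longrightarrow> f v = v" "v \<in> D \<Longrightarrow> f v = v"
  using f_outside parts by (auto simp: D_def)

lemma f_eq_imp: "f x = v \<Longrightarrow> v \<notin> In \<Longrightarrow> x = v"
  using f_In f_outside by metis

lemma f_mem_iff: "f x \<in> L \<longleftrightarrow> x \<in> L" "f x \<in> Out \<longleftrightarrow> x \<in> Out" "f x \<in> In \<longleftrightarrow> x \<in> In" "f x \<in> D \<longleftrightarrow> x \<in> D"
  using f_In[of x] f_outside[of x] parts by (cases "x \<in> In"; auto simp: D_def)+

lemma f_image_L: "S \<subseteq> L \<Longrightarrow> f ` S = S"
  by (force simp: image_iff)

lemma f_mem_image_iff: "f x \<in> f ` In \<union> S \<longleftrightarrow> x \<in> In \<union> S" if "S \<subseteq> L"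
proof (cases "x \<in> In")
  case False
  then show ?thesis using f_outside[of x] f_In by auto
qed simp

text \<open>Independence of \<open>L\<close> sharpens the disjunction in the definition of
  \<open>G'\<close>: exactly one end of an arc lies in \<open>L\<close>.\<close>

lemma arc_G'E:
  assumes "(u, v) \<in> parcs G'"
  obtains x y where "u = f x" "v = f y" "(x, y) \<in> parcs G" "x \<in> L \<longleftrightarrow> y \<notin> L" "x \<notin> D" "y \<notin> D"
  using assms L_independent by (fastforce simp: G'_def)

lemma arc_G'I:
  "(x, y) \<in> parcs G \<Longrightarrow> x \<in> L \<or> y \<in> L \<Longrightarrow> x \<notin> D \<Longrightarrow> y \<notin> D \<Longrightarrow> (f x, f y) \<in> parcs G'"
  by (force simp: G'_def)

lemma arcs_sym': "(u, v) \<in> parcs G' \<Longrightarrow> (v, u) \<in> parcs G'"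
  by (elim arc_G'E) (auto intro: arc_G'I arcs_sym)

section \<open>The contracted graph is an excellent instance\<close>

lemma pair_graph_G': "pair_graph G'"
proof unfold_locales
  show "finite (pverts G')" "finite (parcs G')"
    using finite_verts finite_arcs by (auto simp: G'_def intro: finite_subset)
  show "symmetric G'"
    by (auto simp: symmetric_def intro: symI arcs_sym')
  fix e assume "e \<in> parcs G'"
  then obtain x y where xy: "e = (f x, f y)" "(x, y) \<in> parcs G" "x \<in> L \<longleftrightarrow> y \<notin> L" "x \<notin> D" "y \<notin> D"
    by (cases e) (auto elim!: arc_G'E)
  then show "fst e \<in> pverts G'" "snd e \<in> pverts G'"
    using arcs_verts[of x y] by (auto simp: G'_def f_mem_iff)
  \<comment> \<open>Exactly one of \<open>x\<close>, \<open>y\<close> is in \<open>L\<close>, and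
    \<open>f\<close> respects membership in \<open>L\<close>; so contraction creates no
    loops.\<close>
  show "fst e \<noteq> snd e"
    using xy f_mem_iff(1)[of x] f_mem_iff(1)[of y] by auto
qed

lemma bipartition_G': "bipartition_of ((f ` H - D) \<union> (f ` R - D - f ` H)) (f ` In) (Out - D)"
proof -
  have "f ` Out = Out" by (auto simp: image_iff)
  moreover have "f ` H \<union> f ` R = f ` In \<union> f ` Out"
    using HR(2) by (metis image_Un)
  moreover have "f ` In \<inter> Out = {}" "D \<subseteq> Out"
    using f_In parts by (auto simp: D_def)
  ultimately show ?thesis
    by (auto simp: bipartition_of_def)
qed

lemma excellent_G': "excellent_partition l G' L (f ` H - D) (f ` R - D - f ` H)"
proof -
  let ?H = "f ` H - D" and ?R = "f ` R - D - f ` H"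
  have "f ` L = L" by (auto simp: image_iff)
  then have "f ` pverts G = L \<union> f ` H \<union> f ` R"
    by (simp add: HR(1) image_Un)
  moreover have "L \<inter> D = {}" using parts by (auto simp: D_def)
  moreover have "L \<inter> (f ` H \<union> f ` R) = {}"
    using HR(3) by (auto simp: f_mem_iff(1))
  ultimately have "tripartition_of (pverts G') L ?H ?R"
    by (auto simp: tripartition_of_def G'_def)
  moreover have "10 * card ?H \<le> card L"
  proof -
    have "finite H" using finite_verts HR(1) by simp
    then have "card ?H \<le> card H"
      by (meson card_image_le card_mono Diff_subset finite_imageI le_trans)
    then show ?thesis using good by (auto simp: good_partition_def)
  qed
  moreover have "edgeless_on G' L"
    by (auto simp: edgeless_on_iff f_mem_iff elim!: arc_G'E)
  moreover have "edgeless_on G' (?H \<union> ?R)"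
    unfolding edgeless_on_iff
  proof (intro ballI notI)
    fix u v assume uv: "u \<in> ?H \<union> ?R" "v \<in> ?H \<union> ?R" and "(u, v) \<in> parcs G'"
    then have "u \<in> L \<or> v \<in> L"
      by (elim arc_G'E) (auto simp: f_mem_iff(1))
    then show False using uv \<open>L \<inter> (f ` H \<union> f ` R) = {}\<close> by blast
  qed
  moreover have "card {r \<in> ?R. (v, r) \<in> parcs G'} < l" if "v \<in> L" for v
  proof -
    have "{r \<in> ?R. (v, r) \<in> parcs G'} \<subseteq> f ` {r \<in> R. (v, r) \<in> parcs G}"
    proof
      fix r assume "r \<in> {r \<in> ?R. (v, r) \<in> parcs G'}"
      then have r: "r \<in> ?R" "(v, r) \<in> parcs G'" by auto
      from r(2) obtain x y where xy: "v = f x" "r = f y" "(x, y) \<in> parcs G" "x \<in> L \<longleftrightarrow> y \<notin> L"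
        by (rule arc_G'E)
      have "x \<in> L" using that xy(1) f_mem_iff(1)[of x] by simp
      then have "x = v" using xy(1) by simp
      \<comment> \<open>If \<open>y\<close> were in \<open>H\<close>, then \<open>r = f y\<close>
        would lie in the image of \<open>H\<close>, which has been removed from the new
        \<open>R\<close>-part.\<close>
      moreover have "y \<in> R"
        using \<open>x \<in> L\<close> xy(2,4) r(1) arcs_verts[OF xy(3)] by (auto simp: HR(1))
      ultimately show "r \<in> f ` {r \<in> R. (v, r) \<in> parcs G}"
        using xy by auto
    qed
    moreover have "finite {r \<in> R. (v, r) \<in> parcs G}"
      using finite_verts HR(1) by simp
    ultimately have "card {r \<in> ?R. (v, r) \<in> parcs G'} \<le> card {r \<in> R. (v, r) \<in> parcs G}"
      by (meson card_image_le card_mono finite_imageI le_trans)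
    then show ?thesis using good that by (fastforce simp: good_partition_def)
  qed
  ultimately show ?thesis
    by (simp add: excellent_partition_def good_partition_def)
qed

section \<open>Extensions before and after contraction\<close>

lemma connected_iff:
  assumes S: "S \<subseteq> L"
  shows "Digraph_Component.connected (with_proj G' \<restriction> (f ` In \<union> S)) \<longleftrightarrow>
    Digraph_Component.connected (with_proj G \<restriction> (In \<union> S))"
proof -
  let ?X = "In \<union> S" and ?X' = "f ` In \<union> S"
  let ?E = "parcs G \<inter> ?X \<times> ?X" and ?E' = "parcs G' \<inter> ?X' \<times> ?X'"
  have X': "?X' = f ` ?X" using f_image_L[OF S] by (simp add: image_Un)
  have S_disj: "S \<inter> D = {}" "In \<inter> D = {}" using S parts by (auto simp: D_def)
  have sym_E: "sym (?E\<^sup>*)"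
    by (intro sym_rtrancl symI) (auto intro: arcs_sym)
  have to_f: "(u, f u) \<in> ?E\<^sup>*" if "u \<in> ?X" for u
  proof (cases "u \<in> In")
    case True
    have "parcs G \<inter> In \<times> In \<subseteq> ?E" by auto
    with f_path[OF True] show ?thesis by (meson rtrancl_mono subsetD)
  next
    case False
    then show ?thesis by (simp add: f_outside)
  qed
  have down: "(f u, f v) \<in> ?E'\<^sup>*" if "(u, v) \<in> ?E\<^sup>*" for u v
    using that
  proof induction
    case (step y z)
    have "(f y, f z) \<in> ?E'\<^sup>*"
    proof (cases "y \<in> In \<and> z \<in> In")
      case True
      then show ?thesis using step f_arc by auto
    next
      \<comment> \<open>An arc within \<open>In \<union> S\<close> but not within \<open>In\<close>
        meets \<open>S\<close>, hence \<open>L\<close>, so \<open>G'\<close> keeps its image. Arcs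
        within \<open>In\<close> collapse to a point.\<close>
      case False
      then have "(f y, f z) \<in> parcs G'"
        using step S S_disj by (intro arc_G'I) auto
      then show ?thesis using step X' by auto
    qed
    with step.IH show ?case by auto
  qed simp
  \<comment> \<open>An arc \<open>(f x, f y)\<close> lifts to a walk through \<open>f x\<close>,
    \<open>x\<close>, \<open>y\<close>, \<open>f y\<close> in \<open>G\<close>; its outer pieces
    stay inside \<open>In \<union> S\<close> by \<open>to_f\<close>.\<close>
  have up: "?E' \<subseteq> ?E\<^sup>*"
  proof clarify
    fix u v assume "(u, v) \<in> parcs G'" and uv: "u \<in> ?X'" "v \<in> ?X'"
    then obtain x y where xy: "u = f x" "v = f y" "(x, y) \<in> parcs G"
      by (elim arc_G'E)
    have "(f x, x) \<in> ?E\<^sup>*" "(x, y) \<in> ?E\<^sup>*" "(y, f y) \<in> ?E\<^sup>*"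
      using xy uv to_f sym_E f_mem_image_iff[OF S] by (auto dest: symD)
    with xy show "(u, v) \<in> ?E\<^sup>*" by simp
  qed
  have "(\<forall>u\<in>?X'. \<forall>v\<in>?X'. (u, v) \<in> ?E'\<^sup>*) \<longleftrightarrow> (\<forall>u\<in>?X. \<forall>v\<in>?X. (u, v) \<in> ?E\<^sup>*)"
  proof (intro iffI ballI)
    fix u v assume *: "\<forall>u\<in>?X'. \<forall>v\<in>?X'. (u, v) \<in> ?E'\<^sup>*" and uv: "u \<in> ?X" "v \<in> ?X"
    then have "(f u, f v) \<in> ?E'\<^sup>*" using X' by blast
    then have "(f u, f v) \<in> ?E\<^sup>*" by (rule subsetD[OF rtrancl_subset_rtrancl[OF up]])
    then show "(u, v) \<in> ?E\<^sup>*"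
      using to_f[OF uv(1)] to_f[OF uv(2)] sym_E by (blast intro: rtrancl_trans dest: symD)
  next
    fix u v assume *: "\<forall>u\<in>?X. \<forall>v\<in>?X. (u, v) \<in> ?E\<^sup>*" and uv: "u \<in> ?X'" "v \<in> ?X'"
    then show "(u, v) \<in> ?E'\<^sup>*" using down unfolding X' by blast
  qed
  moreover have "sym (parcs G)" "sym (parcs G')"
    by (auto intro: symI arcs_sym arcs_sym')
  ultimately show ?thesis
    by (simp add: connected_induce_iff)
qed

text \<open>Vertices of \<open>D\<close> are absent from \<open>G'\<close> and dominated by
  \<open>In\<close> in \<open>G\<close>. For every other vertex outside
  \<open>In \<union> S\<close>, an edge to a dominator necessarily meets \<open>L\<close> and
  therefore survives.\<close>

lemma dominating_iff:
  assumes S: "S \<subseteq> L"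
  shows "(\<forall>v \<in> pverts G' - (f ` In \<union> S). \<exists>u \<in> f ` In \<union> S. (v, u) \<in> parcs G') \<longleftrightarrow>
    (\<forall>v \<in> pverts G - (In \<union> S). \<exists>u \<in> In \<union> S. (v, u) \<in> parcs G)"
proof (intro iffI ballI)
  fix v assume dom: "\<forall>v \<in> pverts G' - (f ` In \<union> S). \<exists>u \<in> f ` In \<union> S. (v, u) \<in> parcs G'"
    and "v \<in> pverts G - (In \<union> S)"
  then have v: "v \<in> pverts G" "v \<notin> In" "v \<notin> S" by auto
  show "\<exists>u \<in> In \<union> S. (v, u) \<in> parcs G"
  proof (cases "v \<in> D")
    case True
    then show ?thesis by (auto simp: D_def)
  next
    case False
    then have "v \<in> pverts G'"
      using v f_outside[of v] by (force simp: G'_def)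
    moreover have "v \<notin> f ` In" using v f_In by auto
    ultimately obtain u where u: "u \<in> f ` In \<union> S" "(v, u) \<in> parcs G'"
      using dom v by blast
    then obtain x y where xy: "v = f x" "u = f y" "(x, y) \<in> parcs G"
      by (elim arc_G'E)
    then have "x = v" using v f_eq_imp[of x v] by simp
    moreover have "y \<in> In \<union> S"
      using u(1) xy(2) f_mem_image_iff[OF S, of y] by simp
    ultimately show ?thesis using xy by blast
  qed
next
  fix v assume dom: "\<forall>v \<in> pverts G - (In \<union> S). \<exists>u \<in> In \<union> S. (v, u) \<in> parcs G"
    and "v \<in> pverts G' - (f ` In \<union> S)"
  then have v: "v \<in> pverts G'" "v \<notin> f ` In" "v \<notin> S" by auto
  have "v \<notin> D" using v(1) by (simp add: G'_def)
  obtain x where x: "v = f x" "x \<in> pverts G"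
    using v(1) by (auto simp: G'_def)
  then have "x \<notin> In" using v(2) by blast
  then have "x = v" using x(1) f_outside[of x] by simp
  with x(2) \<open>x \<notin> In\<close> have v': "v \<in> pverts G" "v \<notin> In" by auto
  then obtain u where u: "u \<in> In \<union> S" "(v, u) \<in> parcs G"
    using dom v(3) by blast
  have "v \<in> L \<or> v \<in> Out" using v' by (simp add: parts(1))
  \<comment> \<open>If \<open>v\<close> is in \<open>Out\<close>, then \<open>v \<notin> D\<close>
    rules out \<open>u \<in> In\<close>, leaving \<open>u \<in> S \<subseteq> L\<close>.\<close>
  then have "v \<in> L \<or> u \<in> L"
    using u \<open>v \<notin> D\<close> S by (auto simp: D_def)
  moreover have "u \<notin> D" using u(1) S parts by (auto simp: D_def)
  ultimately have "(f v, f u) \<in> parcs G'"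
    using u \<open>v \<notin> D\<close> by (intro arc_G'I)
  moreover have "f u \<in> f ` In \<union> S"
    using u(1) f_mem_image_iff[OF S] by blast
  ultimately show "\<exists>u \<in> f ` In \<union> S. (v, u) \<in> parcs G'"
    using f_outside[OF v'(2)] by auto
qed

lemma extension_iff:
  assumes S: "S \<subseteq> L"
  shows "extension G' (f ` In) (Out - D) S \<longleftrightarrow> extension G In Out S"
proof -
  have "S \<subseteq> pverts G" "S \<inter> D = {}" "In \<subseteq> pverts G" "f ` In \<inter> D = {}"
    using S parts f_In by (auto simp: D_def dest: f_In)
  then have "S \<subseteq> pverts G'" "f ` In \<subseteq> pverts G'"
    using image_mono[of S "pverts G" f] f_image_L[OF S] by (auto simp: G'_def)
  moreover have "S \<inter> (f ` In \<union> (Out - D)) = {}"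
    using S parts(3,4) image_subsetI[of In f In, OF f_In] by blast
  moreover have "S \<subseteq> pverts G" "In \<subseteq> pverts G" "S \<inter> (In \<union> Out) = {}"
    using S parts by auto
  ultimately show ?thesis
    by (simp add: extension_def connected_dominating_set_def connected_iff[OF S] dominating_iff[OF S])
qed

text \<open>All competitors of \<open>S\<close> are subsets of \<open>S\<close>, hence of
  \<open>L\<close>, so the equivalence for extensions covers them too.\<close>

lemma minimal_extension_iff:
  assumes "S \<subseteq> L"
  shows "minimal_extension G In Out S \<longleftrightarrow> minimal_extension G' (f ` In) (Out - D) S"
proof -
  have "extension G' (f ` In) (Out - D) T \<longleftrightarrow> extension G In Out T" if "T \<subseteq> S" for T
    using that assms by (intro extension_iff) simp
  then show ?thesis
    by (simp add: minimal_extension_def psubset_eq cong: conj_cong)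
qed

end

section \<open>Polynomial-time functions on encoded data\<close>

text \<open>Injectivity lets a comparison of trees by \<open>Eq\<close> decide equality of the
  encoded values.\<close>

class encodable =
  fixes encode :: "'a \<Rightarrow> data"
  assumes encode_inject: "encode x = encode y \<Longrightarrow> x = y"

instantiation nat :: encodable
begin
definition "encode_nat = enc_nat"
instance by standard (simp add: encode_nat_def enc_nat_inject)
end

text \<open>Sharing \<open>Leaf\<close> with the empty list makes a nested tuple ending in
  \<open>()\<close> look like a list with entries of different types, which is the format of
  instances.\<close>

instantiation unit :: encodable
begin
definition "encode_unit (u :: unit) = Leaf"
instance by standard simp
end

text \<open>With \<open>False\<close> as \<open>Leaf\<close>, an encoded truth value serves directly
  as a condition and agrees with the result of \<open>Eq\<close>.\<close>

instantiation bool :: encodable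
begin
definition "encode_bool b = (if b then Node Leaf Leaf else Leaf)"
instance by standard (simp add: encode_bool_def split: if_splits)
end

instantiation prod :: (encodable, encodable) encodable
begin
definition "encode_prod p = Node (encode (fst p)) (encode (snd p))"
instance by standard (auto simp: encode_prod_def prod_eq_iff dest: encode_inject)
end

instantiation list :: (encodable) encodable
begin
definition "encode_list = enc_list (encode :: 'a \<Rightarrow> data)"
instance
  by standard (simp add: encode_list_def, rule enc_list_inject, auto intro: injI dest: encode_inject)
end

lemma encode_Pair [simp]: "encode (x, y) = Node (encode x) (encode y)"
  by (simp add: encode_prod_def)

lemma encode_Nil [simp]: "encode [] = Leaf"
  and encode_Cons [simp]: "encode (x # xs) = Node (encode x) (encode xs)"
  by (simp_all add: encode_list_def)

lemma encode_eq_iff [simp]: "encode x = encode y \<longleftrightarrow> x = y"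
  using encode_inject by blast

abbreviation esize :: "'a::encodable \<Rightarrow> nat" where
  "esize x \<equiv> size (encode x)"

lemma length_le_esize: "length xs \<le> esize xs"
  by (induction xs) auto

lemma esize_mem: "x \<in> set xs \<Longrightarrow> esize x \<le> esize xs"
  by (induction xs) auto

lemma esize_list_le: "(\<And>x. x \<in> set xs \<Longrightarrow> esize x \<le> b) \<Longrightarrow> esize xs \<le> length xs * (b + 1)"
proof (induction xs)
  case (Cons x xs)
  then have "esize x \<le> b" "esize xs \<le> length xs * (b + 1)" by auto
  then show ?case by simp
qed simp

text \<open>Natural coefficients make polynomials monotone; this turns a bound in an intermediate
  size into one in the input size.\<close>

lemma poly_nat_mono: "m \<le> n \<Longrightarrow> poly p m \<le> poly p n" for p :: "nat poly"
  by (induction p) (auto intro: add_mono mult_mono)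

lemma size_val_le_cost: "size (val e s) \<le> cost e s"
  by (induction e) auto

text \<open>
  The program must cope with arbitrary contents of the variables it uses as scratch and leave all
  variables above \<open>N\<close> alone; this makes programs composable without renaming, as a value that
  has to survive a call can be parked above the \<open>N\<close> of the callee.
\<close>

definition realizes :: "com \<Rightarrow> nat \<Rightarrow> nat poly \<Rightarrow> ('a::encodable \<Rightarrow> 'b::encodable) \<Rightarrow> bool" where
  "realizes c N p f \<longleftrightarrow> (\<forall>a s. s 0 = encode a \<longrightarrow>
     (\<exists>t s'. exec c s t s' \<and> s' 0 = encode (f a) \<and> (\<forall>x>N. s' x = s x) \<and>
       t \<le> poly p (esize a) \<and> esize (f a) \<le> poly p (esize a)))"

definition poly_time :: "('a::encodable \<Rightarrow> 'b::encodable) \<Rightarrow> bool" where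
  "poly_time f \<longleftrightarrow> (\<exists>c N p. realizes c N p f)"

lemma poly_timeE:
  assumes "poly_time f"
  obtains c N p where "realizes c N p f"
  using assms by (auto simp: poly_time_def)

lemma realizesE:
  assumes "realizes c N p f" and "s 0 = encode a"
  obtains t s' where "exec c s t s'" "s' 0 = encode (f a)" "\<forall>x>N. s' x = s x"
    "t \<le> poly p (esize a)" "esize (f a) \<le> poly p (esize a)"
  using assms by (fastforce simp: realizes_def)

lemma poly_timeI:
  fixes f :: "'a::encodable \<Rightarrow> 'b::encodable"
  assumes "\<And>a s. s 0 = encode a \<Longrightarrow> \<exists>t s'. exec c s t s' \<and> s' 0 = encode (f a) \<and>
    (\<forall>x>N. s' x = s x) \<and> t \<le> poly p (esize a) \<and> esize (f a) \<le> poly q (esize a)"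
  shows "poly_time f"
proof -
  have "realizes c N (p + q) f"
    unfolding realizes_def
  proof (intro allI impI)
    fix a :: 'a and s :: store assume "s 0 = encode a"
    from assms[of s a, OF this] obtain t s' where "exec c s t s'" "s' 0 = encode (f a)"
      "\<forall>x>N. s' x = s x" "t \<le> poly p (esize a)" "esize (f a) \<le> poly q (esize a)"
      by blast
    then show "\<exists>t s'. exec c s t s' \<and> s' 0 = encode (f a) \<and> (\<forall>x>N. s' x = s x) \<and>
       t \<le> poly (p + q) (esize a) \<and> esize (f a) \<le> poly (p + q) (esize a)"
      by (intro exI[of _ t] exI[of _ s']) simp
  qed
  then show ?thesis by (auto simp: poly_time_def)
qed

section \<open>Basic closure properties of polynomial time\<close>

lemma exec_AssignI:
  "val e s = v \<Longrightarrow> 1 + cost e s = t \<Longrightarrow> exec (Assign x e) s t (s(x := v))"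
  using exec.Assign by blast

lemma poly_time_expr:
  fixes f :: "'a::encodable \<Rightarrow> 'b::encodable"
  assumes "\<And>a s. s 0 = encode a \<Longrightarrow> val e s = encode (f a) \<and> cost e s \<le> poly p (esize a)"
  shows "poly_time f"
proof (rule poly_timeI)
  fix a :: 'a and s :: store assume s: "s 0 = encode a"
  show "\<exists>t s'. exec (Assign 0 e) s t s' \<and> s' 0 = encode (f a) \<and> (\<forall>x>0. s' x = s x) \<and>
     t \<le> poly (1 + p) (esize a) \<and> esize (f a) \<le> poly p (esize a)"
    using exec.Assign[of 0 e s] assms[of s a, OF s] size_val_le_cost[of e s] by force
qed

text \<open>The second program runs on a value whose size is at most \<open>p\<close> of the input
  size, which is why \<open>realizes\<close> bounds the output as well. Its share of the time is
  then at most \<open>q \<circ>\<^sub>p p\<close>.\<close>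

lemma poly_time_comp:
  fixes f :: "'a::encodable \<Rightarrow> 'b::encodable"
  assumes "poly_time g" "poly_time f"
  shows "poly_time (\<lambda>x. g (f x))"
proof -
  obtain c N p where f: "realizes c N p f" using assms(2) by (rule poly_timeE)
  obtain d M q where g: "realizes d M q g" using assms(1) by (rule poly_timeE)
  show ?thesis
  proof (rule poly_timeI)
    fix a :: 'a and s :: store assume s: "s 0 = encode a"
    obtain t s' where 1: "exec c s t s'" "s' 0 = encode (f a)" "\<forall>x>N. s' x = s x"
      "t \<le> poly p (esize a)" "esize (f a) \<le> poly p (esize a)"
      by (rule realizesE[where s = s and a = a, OF f s]) (rule that)
    obtain u s'' where 2: "exec d s' u s''" "s'' 0 = encode (g (f a))" "\<forall>x>M. s'' x = s' x"
      "u \<le> poly q (esize (f a))" "esize (g (f a)) \<le> poly q (esize (f a))"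
      by (rule realizesE[where s = s' and a = "f a", OF g 1(2)]) (rule that)
    have "poly q (esize (f a)) \<le> poly (q \<circ>\<^sub>p p) (esize a)"
      using poly_nat_mono[OF 1(5)] by (simp add: poly_pcompose)
    then show "\<exists>t s'. exec (Seq c d) s t s' \<and> s' 0 = encode (g (f a)) \<and> (\<forall>x>max N M. s' x = s x) \<and>
       t \<le> poly (1 + p + q \<circ>\<^sub>p p) (esize a) \<and> esize (g (f a)) \<le> poly (q \<circ>\<^sub>p p) (esize a)"
      using exec.Seq[OF 1(1) 2(1)] 1 2 by (intro exI[of _ "1 + t + u"] exI[of _ s'']) auto
  qed
qed

lemma poly_time_id: "poly_time (\<lambda>x. x)"
  by (rule poly_time_expr[of "Var 0" _ "[:1, 1:]"]) simp

text \<open>A fixed tree is written out by a fixed expression whose cost does not depend on the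
  store.\<close>

lemma poly_time_const: "poly_time (\<lambda>x. c)"
proof -
  have "\<exists>e n. \<forall>s. val e s = d \<and> cost e s = n" for d
  proof (induction d)
    case Leaf
    show ?case by (intro exI[of _ NilE] exI[of _ 1]) simp
  next
    case (Node d1 d2)
    then obtain e f m n where "\<forall>s. val e s = d1 \<and> cost e s = m" "\<forall>s. val f s = d2 \<and> cost f s = n"
      by blast
    then show ?case
      by (intro exI[of _ "ConsE e f"] exI[of _ "m + n + 1 + size (Node d1 d2)"]) simp
  qed
  then obtain e n where e: "\<And>s. val e s = encode c" "\<And>s. cost e s = n" by blast
  show ?thesis
    by (rule poly_time_expr[of e _ "[:n:]"]) (simp add: e)
qed

lemma poly_time_pair:
  fixes f :: "'a::encodable \<Rightarrow> 'b::encodable" and g :: "'a \<Rightarrow> 'c::encodable"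
  assumes "poly_time f" "poly_time g"
  shows "poly_time (\<lambda>x. (f x, g x))"
proof -
  obtain c N p where f: "realizes c N p f" using assms(1) by (rule poly_timeE)
  obtain d M q where g: "realizes d M q g" using assms(2) by (rule poly_timeE)
  \<comment> \<open>\<open>K\<close> lies above the scratch of both programs: it keeps the input
    during the first call, and \<open>Suc K\<close> keeps \<open>f a\<close> during the
    second.\<close>
  define K where "K = Suc (max N M)"
  let ?prog = "Seq (Assign K (Var 0)) (Seq c (Seq (Assign (Suc K) (Var 0)) (Seq (Assign 0 (Var K))
    (Seq d (Assign 0 (ConsE (Var (Suc K)) (Var 0)))))))"
  show ?thesis
  proof (rule poly_timeI)
    fix a :: 'a and s :: store assume s: "s 0 = encode a"
    let ?s1 = "s(K := encode a)"
    have e1: "exec (Assign K (Var 0)) s (2 + esize a) ?s1"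
      by (rule exec_AssignI) (use s in simp_all)
    have "?s1 0 = encode a" using s by (simp add: K_def)
    then obtain t2 s2 where 2: "exec c ?s1 t2 s2" "s2 0 = encode (f a)" "\<forall>x>N. s2 x = ?s1 x"
      "t2 \<le> poly p (esize a)" "esize (f a) \<le> poly p (esize a)"
      by (rule realizesE[where s = "?s1" and a = "a", OF f]) (rule that)
    let ?s3 = "s2(Suc K := encode (f a))"
    have e3: "exec (Assign (Suc K) (Var 0)) s2 (2 + esize (f a)) ?s3"
      by (rule exec_AssignI) (use 2(2) in simp_all)
    have K3: "?s3 K = encode a" using 2(3)[rule_format, of K] by (simp add: K_def)
    let ?s4 = "?s3(0 := encode a)"
    have e4: "exec (Assign 0 (Var K)) ?s3 (2 + esize a) ?s4"
      by (rule exec_AssignI) (use K3 in simp_all)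
    have "?s4 0 = encode a" by simp
    then obtain t5 s5 where 5: "exec d ?s4 t5 s5" "s5 0 = encode (g a)" "\<forall>x>M. s5 x = ?s4 x"
      "t5 \<le> poly q (esize a)" "esize (g a) \<le> poly q (esize a)"
      by (rule realizesE[where s = "?s4" and a = "a", OF g]) (rule that)
    have "s5 (Suc K) = encode (f a)" using 5(3)[rule_format, of "Suc K"] by (simp add: K_def)
    with 5(2) have e6: "exec (Assign 0 (ConsE (Var (Suc K)) (Var 0))) s5
        (5 + 2 * esize (f a) + 2 * esize (g a)) (s5(0 := encode (f a, g a)))"
      by (intro exec_AssignI) simp_all
    note e = exec.Seq[OF e1 exec.Seq[OF 2(1) exec.Seq[OF e3 exec.Seq[OF e4 exec.Seq[OF 5(1) e6]]]]]
    have "(s5(0 := encode (f a, g a))) x = s x" if "x > Suc K" for x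
      using that 2(3)[rule_format, of x] 5(3)[rule_format, of x] by (auto simp: K_def)
    with e 2 5 show "\<exists>t s'. exec ?prog s t s' \<and> s' 0 = encode (f a, g a) \<and> (\<forall>x>Suc K. s' x = s x) \<and>
       t \<le> poly ([:20, 2:] + 4 * p + 4 * q) (esize a) \<and> esize (f a, g a) \<le> poly (1 + p + q) (esize a)"
      by (intro exI conjI) (assumption | simp)+
  qed
qed

lemma poly_time_fst: "poly_time f \<Longrightarrow> poly_time (\<lambda>x. fst (f x))"
  by (erule poly_time_comp[rotated], rule poly_time_expr[of "Hd (Var 0)" _ "[:2, 2:]"])
    (auto simp: encode_prod_def)

lemma poly_time_snd: "poly_time f \<Longrightarrow> poly_time (\<lambda>x. snd (f x))"
  by (erule poly_time_comp[rotated], rule poly_time_expr[of "Tl (Var 0)" _ "[:2, 2:]"])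
    (auto simp: encode_prod_def)

lemma poly_time_eq:
  assumes "poly_time f" "poly_time g"
  shows "poly_time (\<lambda>x. f x = g x)"
proof -
  have "poly_time (\<lambda>p. fst p = snd p)"
    by (rule poly_time_expr[of "Eq (Hd (Var 0)) (Tl (Var 0))" _ "[:10, 4:]"])
      (auto simp: encode_prod_def encode_bool_def)
  from poly_time_comp[OF this poly_time_pair[OF assms]] show ?thesis by simp
qed

text \<open>A list cell and a pair have the same tree, so the pairing program serves
  unchanged.\<close>

lemma poly_time_Cons:
  assumes "poly_time f" "poly_time g"
  shows "poly_time (\<lambda>x. f x # g x)"
  using poly_time_pair[OF assms] by (simp add: poly_time_def realizes_def)

lemma poly_time_if:
  fixes f :: "'a::encodable \<Rightarrow> 'b::encodable"
  assumes "poly_time b" "poly_time f" "poly_time g"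
  shows "poly_time (\<lambda>x. if b x then f x else g x)"
proof -
  obtain e L r where b: "realizes e L r b" using assms(1) by (rule poly_timeE)
  obtain c N p where f: "realizes c N p f" using assms(2) by (rule poly_timeE)
  obtain d M q where g: "realizes d M q g" using assms(3) by (rule poly_timeE)
  define K where "K = Suc (max L (max N M))"
  let ?prog = "Seq (Assign K (Var 0)) (Seq e (Cond (Var 0) (Seq (Assign 0 (Var K)) c) (Seq (Assign 0 (Var K)) d)))"
  let ?h = "\<lambda>x. if b x then f x else g x"
  show ?thesis
  proof (rule poly_timeI)
    fix a :: 'a and s :: store assume s: "s 0 = encode a"
    let ?s1 = "s(K := encode a)"
    have e1: "exec (Assign K (Var 0)) s (2 + esize a) ?s1"
      by (rule exec_AssignI) (use s in simp_all)
    have "?s1 0 = encode a" using s by (simp add: K_def)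
    then obtain t2 s2 where 2: "exec e ?s1 t2 s2" "s2 0 = encode (b a)" "\<forall>x>L. s2 x = ?s1 x"
      "t2 \<le> poly r (esize a)" "esize (b a) \<le> poly r (esize a)"
      by (rule realizesE[where s = "?s1" and a = "a", OF b]) (rule that)
    have K2: "s2 K = encode a" using 2(3)[rule_format, of K] by (simp add: K_def)
    let ?s3 = "s2(0 := encode a)"
    have e3: "exec (Assign 0 (Var K)) s2 (2 + esize a) ?s3"
      by (rule exec_AssignI) (use K2 in simp_all)
    have s3: "?s3 0 = encode a" by simp
    from s3 obtain t4 s4 where 4: "exec c ?s3 t4 s4" "s4 0 = encode (f a)" "\<forall>x>N. s4 x = ?s3 x"
      "t4 \<le> poly p (esize a)" "esize (f a) \<le> poly p (esize a)"
      by (rule realizesE[where s = "?s3" and a = "a", OF f]) (rule that)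
    from s3 obtain t5 s5 where 5: "exec d ?s3 t5 s5" "s5 0 = encode (g a)" "\<forall>x>M. s5 x = ?s3 x"
      "t5 \<le> poly q (esize a)" "esize (g a) \<le> poly q (esize a)"
      by (rule realizesE[where s = "?s3" and a = "a", OF g]) (rule that)
    have c2: "cost (Var 0) s2 \<le> 1 + poly r (esize a)" using 2 by simp
    show "\<exists>t s'. exec ?prog s t s' \<and> s' 0 = encode (?h a) \<and> (\<forall>x>K. s' x = s x) \<and>
       t \<le> poly ([:20, 2:] + 2 * r + p + q) (esize a) \<and> esize (?h a) \<le> poly (p + q) (esize a)"
    proof (cases "b a")
      case True
      then have "val (Var 0) s2 \<noteq> Leaf" using 2 by (simp add: encode_bool_def)
      note e = exec.Seq[OF e1 exec.Seq[OF 2(1) exec.CondTrue[OF this exec.Seq[OF e3 4(1)]]]]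
      show ?thesis
      proof (intro exI conjI, rule e)
        show "\<forall>x>K. s4 x = s x" using 2(3) 4(3) by (auto simp: K_def)
      qed (use True 2 4 c2 in auto)
    next
      case False
      then have "val (Var 0) s2 = Leaf" using 2 by (simp add: encode_bool_def)
      note e = exec.Seq[OF e1 exec.Seq[OF 2(1) exec.CondFalse[OF this exec.Seq[OF e3 5(1)]]]]
      show ?thesis
      proof (intro exI conjI, rule e)
        show "\<forall>x>K. s5 x = s x" using 2(3) 5(3) by (auto simp: K_def)
      qed (use False 2 5 c2 in auto)
    qed
  qed
qed

lemma poly_time_not: "poly_time f \<Longrightarrow> poly_time (\<lambda>x. \<not> f x)"
  using poly_time_if[OF _ poly_time_const poly_time_const, of f False True] by (simp add: if_bool_eq_conj)

lemma poly_time_conj: "poly_time f \<Longrightarrow> poly_time g \<Longrightarrow> poly_time (\<lambda>x. f x \<and> g x)"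
  using poly_time_if[OF _ _ poly_time_const, of f g False] by (simp add: if_bool_eq_disj)

lemma poly_time_disj: "poly_time f \<Longrightarrow> poly_time g \<Longrightarrow> poly_time (\<lambda>x. f x \<or> g x)"
  using poly_time_if[OF _ poly_time_const, of f g True] by (simp add: if_bool_eq_conj disj_imp)

subsection \<open>Loops over lists\<close>

text \<open>Variable \<open>K\<close> holds the fixed parameter, \<open>K + 1\<close> the
  accumulator and \<open>K + 2\<close> the rest of the list. The body \<open>c\<close> receives
  parameter, accumulator and head as a triple in variable 0.\<close>

definition loop :: "com \<Rightarrow> nat \<Rightarrow> com" where
  "loop c K = While (Var (K + 2))
     (Seq (Assign 0 (ConsE (Var K) (ConsE (Var (K + 1)) (Hd (Var (K + 2))))))
     (Seq c (Seq (Assign (K + 1) (Var 0)) (Assign (K + 2) (Tl (Var (K + 2)))))))"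

text \<open>\<open>B\<close> bounds the accumulator after every prefix, which prevents repeated
  polynomial growth from compounding; \<open>A\<close> bounds parameter and list. The additional
  unit next to \<open>length zs\<close> pays for the final failing test.\<close>

lemma exec_loop:
  fixes h :: "'a::encodable \<Rightarrow> 'b::encodable \<Rightarrow> 'c::encodable \<Rightarrow> 'b"
  assumes c: "realizes c N p (\<lambda>z. h (fst z) (fst (snd z)) (snd (snd z)))" and "N < K"
    and "s K = encode x" "s (K + 1) = encode acc" "s (K + 2) = encode zs"
    and "\<forall>ys ws. zs = ys @ ws \<longrightarrow> esize (foldl (h x) acc ys) \<le> B"
    and "esize x + esize zs \<le> A"
  shows "\<exists>t s'. exec (loop c K) s t s' \<and> s' (K + 1) = encode (foldl (h x) acc zs) \<and>
    (\<forall>y>K + 2. s' y = s y) \<and> t \<le> (length zs + 1) * (30 + 10 * (A + B) + poly p (A + B + 2))"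
  using assms(3-)
proof (induction zs arbitrary: s acc)
  case Nil
  have "exec (loop c K) s (1 + cost (Var (K + 2)) s) s"
    unfolding loop_def by (rule exec.WhileFalse) (use Nil in simp)
  then show ?case
    using Nil by (intro exI[of _ "1 + cost (Var (K + 2)) s"] exI[of _ s]) auto
next
  case (Cons z zs)
  let ?z = "(x, acc, z)"
  let ?h = "\<lambda>z. h (fst z) (fst (snd z)) (snd (snd z))"
  have acc: "esize acc \<le> B" using Cons.prems(4)[rule_format, of "[]"] by simp
  have acc': "esize (h x acc z) \<le> B" using Cons.prems(4)[rule_format, of "[z]"] by simp
  have A: "esize x + esize z + esize zs + 1 \<le> A" using Cons.prems(5) by simp
  have true: "val (Var (K + 2)) s \<noteq> Leaf" using Cons.prems(3) by simp
  let ?s1 = "s(0 := encode ?z)"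
  let ?e = "ConsE (Var K) (ConsE (Var (K + 1)) (Hd (Var (K + 2))))"
  have e1: "exec (Assign 0 ?e) s (1 + cost ?e s) ?s1"
    by (rule exec_AssignI) (use Cons.prems(1-3) in simp_all)
  have "?s1 0 = encode ?z" by simp
  then obtain t2 s2 where 2: "exec c ?s1 t2 s2" "s2 0 = encode (?h ?z)" "\<forall>x>N. s2 x = ?s1 x"
    "t2 \<le> poly p (esize ?z)"
    by (rule realizesE[where s = "?s1" and a = "?z", OF c]) (rule that)
  let ?s3 = "s2(K + 1 := encode (h x acc z))"
  have e3: "exec (Assign (K + 1) (Var 0)) s2 (2 + esize (h x acc z)) ?s3"
    by (rule exec_AssignI) (use 2(2) in simp_all)
  let ?s4 = "?s3(K + 2 := encode zs)"
  have K2: "?s3 (K + 2) = encode (z # zs)" using 2(3)[rule_format, of "K + 2"] Cons.prems(3) \<open>N < K\<close> by simp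
  have e4: "exec (Assign (K + 2) (Tl (Var (K + 2)))) ?s3 (4 + esize z + 2 * esize zs) ?s4"
    by (rule exec_AssignI) (use K2 in simp_all)
  have s4: "?s4 K = encode x" "?s4 (K + 1) = encode (h x acc z)" "?s4 (K + 2) = encode zs"
    using 2(3)[rule_format, of K] Cons.prems(1) \<open>N < K\<close> by auto
  \<comment> \<open>A prefix of the tail, preceded by \<open>z\<close>, is a prefix of the whole
    list, so the bound is inherited.\<close>
  have B: "\<forall>ys ws. zs = ys @ ws \<longrightarrow> esize (foldl (h x) (h x acc z) ys) \<le> B"
    using Cons.prems(4)[rule_format, of "z # ys" for ys] by simp
  have "esize x + esize zs \<le> A" using A by simp
  from Cons.IH[of ?s4 "h x acc z", OF s4 B this] obtain t5 s5 where 5: "exec (loop c K) ?s4 t5 s5"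
    "s5 (K + 1) = encode (foldl (h x) (h x acc z) zs)" "\<forall>y>K + 2. s5 y = ?s4 y"
    "t5 \<le> (length zs + 1) * (30 + 10 * (A + B) + poly p (A + B + 2))"
    by (elim exE conjE) (rule that)
  note body = exec.Seq[OF e1 exec.Seq[OF 2(1) exec.Seq[OF e3 e4]]]
  have all: "exec (loop c K) s (1 + cost (Var (K + 2)) s + (1 + (1 + cost ?e s) + (1 + t2 +
      (1 + (2 + esize (h x acc z)) + (4 + esize z + 2 * esize zs)))) + t5) s5"
    unfolding loop_def by (rule exec.WhileTrue[OF true body 5(1)[unfolded loop_def]])
  \<comment> \<open>The 2 counts the two \<open>Node\<close>s that join the triple.\<close>
  have "esize ?z \<le> A + B + 2" using A acc by simp
  then have "t2 \<le> poly p (A + B + 2)"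
    using 2(4) poly_nat_mono[of "esize ?z" "A + B + 2" p] by linarith
  moreover have "cost ?e s + cost (Var (K + 2)) s + esize (h x acc z) + esize z + 2 * esize zs
      \<le> 15 + 10 * (A + B)"
    using A acc acc' Cons.prems(1-3) by simp
  ultimately have time: "1 + cost (Var (K + 2)) s + (1 + (1 + cost ?e s) + (1 + t2 +
      (1 + (2 + esize (h x acc z)) + (4 + esize z + 2 * esize zs)))) + t5 \<le>
      (length (z # zs) + 1) * (30 + 10 * (A + B) + poly p (A + B + 2))"
    using 5(4) by simp
  have frame: "\<forall>y>K + 2. s5 y = s y"
    using 5(3) 2(3) \<open>N < K\<close> by auto
  have "s5 (K + 1) = encode (foldl (h x) acc (z # zs))" using 5(2) by simp
  then show ?case using all time frame by (intro exI conjI)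
qed

text \<open>The premise \<open>bound\<close> is a genuine restriction: a step that doubles its
  accumulator is polynomial, but its iteration is not.\<close>

lemma poly_time_foldl:
  fixes h :: "'a::encodable \<Rightarrow> 'b::encodable \<Rightarrow> 'c::encodable \<Rightarrow> 'b"
  assumes "poly_time (\<lambda>z. h (fst z) (fst (snd z)) (snd (snd z)))" "poly_time i" "poly_time xs"
    and bound: "\<And>x ys zs. xs x = ys @ zs \<Longrightarrow> esize (foldl (h x) (i x) ys) \<le> poly q (esize x)"
  shows "poly_time (\<lambda>x. foldl (h x) (i x) (xs x))"
proof -
  obtain c Nc pc where h: "realizes c Nc pc (\<lambda>z. h (fst z) (fst (snd z)) (snd (snd z)))"
    using assms(1) by (rule poly_timeE)
  obtain d Nd pd where i: "realizes d Nd pd i" using assms(2) by (rule poly_timeE)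
  obtain e Ne pe where xs: "realizes e Ne pe xs" using assms(3) by (rule poly_timeE)
  define K where "K = Suc (max Nc (max Nd Ne))"
  have K: "Nc < K" "Nd < K" "Ne < K" by (auto simp: K_def)
  let ?prog = "Seq (Assign K (Var 0)) (Seq d (Seq (Assign (K + 1) (Var 0)) (Seq (Assign 0 (Var K))
    (Seq e (Seq (Assign (K + 2) (Var 0)) (Seq (loop c K) (Assign 0 (Var (K + 1)))))))))"
  let ?f = "\<lambda>x. foldl (h x) (i x) (xs x)"
  \<comment> \<open>\<open>w\<close> bounds \<open>A + B\<close> of \<open>exec_loop\<close>: input
    and list make up \<open>A\<close>, the accumulator \<open>B\<close>. \<open>T\<close> is the
    resulting loop time, with \<open>pe\<close> replacing the length of the list.\<close>
  define w :: "nat poly" where "w = [:0, 1:] + pe + q"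
  define T where "T = (pe + 1) * (30 + 10 * w + pc \<circ>\<^sub>p (w + 2))"
  show ?thesis
  proof (rule poly_timeI)
    fix a :: 'a and s :: store assume s: "s 0 = encode a"
    let ?n = "esize a"
    let ?s1 = "s(K := encode a)"
    have e1: "exec (Assign K (Var 0)) s (2 + ?n) ?s1"
      by (rule exec_AssignI) (use s in simp_all)
    have "?s1 0 = encode a" using s by (simp add: K_def)
    then obtain t2 s2 where 2: "exec d ?s1 t2 s2" "s2 0 = encode (i a)" "\<forall>x>Nd. s2 x = ?s1 x"
      "t2 \<le> poly pd ?n" "esize (i a) \<le> poly pd ?n"
      by (rule realizesE[where s = "?s1" and a = "a", OF i]) (rule that)
    let ?s3 = "s2(K + 1 := encode (i a))"
    have e3: "exec (Assign (K + 1) (Var 0)) s2 (2 + esize (i a)) ?s3"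
      by (rule exec_AssignI) (use 2(2) in simp_all)
    have K3: "?s3 K = encode a" using 2(3)[rule_format, of K] K by simp
    let ?s4 = "?s3(0 := encode a)"
    have e4: "exec (Assign 0 (Var K)) ?s3 (2 + ?n) ?s4"
      by (rule exec_AssignI) (use K3 in simp_all)
    have "?s4 0 = encode a" by simp
    then obtain t5 s5 where 5: "exec e ?s4 t5 s5" "s5 0 = encode (xs a)" "\<forall>x>Ne. s5 x = ?s4 x"
      "t5 \<le> poly pe ?n" "esize (xs a) \<le> poly pe ?n"
      by (rule realizesE[where s = "?s4" and a = "a", OF xs]) (rule that)
    let ?s6 = "s5(K + 2 := encode (xs a))"
    have e6: "exec (Assign (K + 2) (Var 0)) s5 (2 + esize (xs a)) ?s6"
      by (rule exec_AssignI) (use 5(2) in simp_all)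
    have s6: "?s6 K = encode a" "?s6 (K + 1) = encode (i a)" "?s6 (K + 2) = encode (xs a)"
      using 5(3)[rule_format, of K] 5(3)[rule_format, of "K + 1"] K3 K by auto
    have accs: "\<forall>ys ws. xs a = ys @ ws \<longrightarrow> esize (foldl (h a) (i a) ys) \<le> poly q ?n"
      using bound by blast
    have size_xs: "?n + esize (xs a) \<le> ?n + poly pe ?n" using 5(5) by simp
    obtain t7 s7 where 7: "exec (loop c K) ?s6 t7 s7"
      "s7 (K + 1) = encode (?f a)" "\<forall>y>K + 2. s7 y = ?s6 y"
      "t7 \<le> (length (xs a) + 1) * (30 + 10 * (?n + poly pe ?n + poly q ?n)
         + poly pc (?n + poly pe ?n + poly q ?n + 2))"
      using exec_loop[where s = ?s6 and x = a and acc = "i a" and zs = "xs a", OF h K(1) s6 accs size_xs]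
      by (elim exE conjE) (rule that)
    have "length (xs a) \<le> poly pe ?n" using length_le_esize[of "xs a"] 5(5) by linarith
    then have "(length (xs a) + 1) * (30 + 10 * (?n + poly pe ?n + poly q ?n)
         + poly pc (?n + poly pe ?n + poly q ?n + 2)) \<le> poly T ?n"
      by (simp add: T_def w_def poly_pcompose) (intro mult_mono; simp)
    then have t7: "t7 \<le> poly T ?n" using 7(4) by linarith
    have size: "esize (?f a) \<le> poly q ?n" using bound[of a "xs a" "[]"] by simp
    have e8: "exec (Assign 0 (Var (K + 1))) s7 (2 + esize (?f a)) (s7(0 := encode (?f a)))"
      by (rule exec_AssignI) (use 7(2) in simp_all)
    note all = exec.Seq[OF e1 exec.Seq[OF 2(1) exec.Seq[OF e3 exec.Seq[OF e4
      exec.Seq[OF 5(1) exec.Seq[OF e6 exec.Seq[OF 7(1) e8]]]]]]]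
    show "\<exists>t s'. exec ?prog s t s' \<and> s' 0 = encode (?f a) \<and> (\<forall>x>K + 2. s' x = s x) \<and>
      t \<le> poly ([:30, 2:] + 2 * pd + 2 * pe + T + q) ?n \<and> esize (?f a) \<le> poly q ?n"
    proof (intro exI conjI, rule all)
      show "\<forall>x>K + 2. (s7(0 := encode (?f a))) x = s x"
        using 7(3) 5(3) 2(3) K by auto
    qed (use 2 5 t7 size in auto)
  qed
qed

section \<open>Polynomial-time list functions\<close>

lemma poly_time_size:
  assumes "poly_time f"
  obtains p :: "nat poly" where "\<And>x. esize (f x) \<le> poly p (esize x)"
proof -
  obtain c N p where f: "realizes c N p f" using assms by (rule poly_timeE)
  have "esize (f x) \<le> poly p (esize x)" for x
    by (rule realizesE[where s = "\<lambda>_. encode x" and a = x, OF f]) auto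
  then show ?thesis by (rule that)
qed

lemma esize_append: "esize (xs @ ys) = esize xs + esize ys"
  by (induction xs) auto

lemma esize_rev [simp]: "esize (rev xs) = esize xs"
  by (induction xs) (auto simp: esize_append)

lemma esize_filter_le: "esize (filter P xs) \<le> esize xs"
  by (induction xs) auto

text \<open>Folding with \<open>Cons\<close> builds lists backwards; this reversal restores the
  order for \<open>map\<close> and \<open>filter\<close>.\<close>

lemma poly_time_rev:
  assumes "poly_time xs"
  shows "poly_time (\<lambda>x. rev (xs x))"
proof -
  obtain p where p: "\<And>x. esize (xs x) \<le> poly p (esize x)" using assms by (rule poly_time_size) blast
  have fold: "foldl (\<lambda>acc e. e # acc) [] ys = rev ys" for ys :: "'b list"
    by (induction ys rule: rev_induct) auto
  have "poly_time (\<lambda>x. foldl (\<lambda>acc e. e # acc) [] (xs x))"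
  proof (rule poly_time_foldl)
    show "esize (foldl (\<lambda>acc e. e # acc) [] ys) \<le> poly p (esize x)" if "xs x = ys @ zs" for x ys zs
      using p[of x] unfolding that by (simp add: fold esize_append)
  qed (intro assms poly_time_const poly_time_Cons poly_time_fst poly_time_snd poly_time_id)+
  then show ?thesis by (simp only: fold)
qed

lemma poly_time_map:
  fixes h :: "'a::encodable \<Rightarrow> 'b::encodable \<Rightarrow> 'c::encodable"
  assumes h: "poly_time (\<lambda>z. h (fst z) (snd z))" and xs: "poly_time xs"
  shows "poly_time (\<lambda>x. map (h x) (xs x))"
proof -
  obtain p where p: "\<And>x. esize (xs x) \<le> poly p (esize x)" using xs by (rule poly_time_size) blast
  obtain q where q: "\<And>z. esize (h (fst z) (snd z)) \<le> poly q (esize z)"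
    using h by (rule poly_time_size) blast
  \<comment> \<open>There are at most \<open>p\<close> entries. Each is an image of a pair
    \<open>(x, e)\<close>, whose size is at most \<open>[:1, 1:] + p\<close>, and costs one more
    \<open>Node\<close> for its list cell.\<close>
  define r where "r = p * (q \<circ>\<^sub>p ([:1, 1:] + p) + 1)"
  have fold: "foldl (\<lambda>acc e. h x e # acc) [] ys = rev (map (h x) ys)" for x ys
    by (induction ys rule: rev_induct) auto
  have "poly_time (\<lambda>x. foldl (\<lambda>acc e. h x e # acc) [] (xs x))"
  proof (rule poly_time_foldl)
    fix x ys zs assume eq: "xs x = ys @ zs"
    let ?b = "poly (q \<circ>\<^sub>p ([:1, 1:] + p)) (esize x)"
    have "esize (h x e) \<le> ?b" if "e \<in> set ys" for e
    proof -
      have "esize e \<le> poly p (esize x)"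
        using esize_mem[of e "xs x"] that p[of x] eq by simp
      then have "poly q (esize (x, e)) \<le> ?b"
        by (auto simp: poly_pcompose intro: poly_nat_mono)
      then show ?thesis using q[of "(x, e)"] by simp
    qed
    then have "esize (map (h x) ys) \<le> length ys * (?b + 1)"
      using esize_list_le[of "map (h x) ys" ?b] by auto
    moreover have "length ys \<le> poly p (esize x)"
      using length_le_esize[of "xs x"] p[of x] eq by simp
    ultimately have "esize (map (h x) ys) \<le> poly p (esize x) * (?b + 1)"
      by (meson le_trans mult_le_mono1)
    then show "esize (foldl (\<lambda>acc e. h x e # acc) [] ys) \<le> poly r (esize x)"
      by (simp add: fold r_def)
  next
    have "poly_time (\<lambda>z :: 'a \<times> 'c list \<times> 'b. (fst z, snd (snd z)))"
      by (intro poly_time_pair poly_time_fst poly_time_snd poly_time_id)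
    from poly_time_comp[OF h this]
    show "poly_time (\<lambda>z. h (fst z) (snd (snd z)) # fst (snd z))"
      by (intro poly_time_Cons poly_time_fst poly_time_snd poly_time_id) simp
  qed (intro xs poly_time_const)+
  from poly_time_rev[OF this] show ?thesis by (simp only: fold rev_rev_ident)
qed

lemma poly_time_filter:
  fixes P :: "'a::encodable \<Rightarrow> 'b::encodable \<Rightarrow> bool"
  assumes P: "poly_time (\<lambda>z. P (fst z) (snd z))" and xs: "poly_time xs"
  shows "poly_time (\<lambda>x. filter (P x) (xs x))"
proof -
  obtain p where p: "\<And>x. esize (xs x) \<le> poly p (esize x)" using xs by (rule poly_time_size) blast
  have fold: "foldl (\<lambda>acc e. if P x e then e # acc else acc) [] ys = rev (filter (P x) ys)" for x ys
    by (induction ys rule: rev_induct) auto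
  have "poly_time (\<lambda>x. foldl (\<lambda>acc e. if P x e then e # acc else acc) [] (xs x))"
  proof (rule poly_time_foldl)
    fix x ys zs assume "xs x = ys @ zs"
    then have "esize ys \<le> poly p (esize x)" using p[of x] by (simp add: esize_append)
    then show "esize (foldl (\<lambda>acc e. if P x e then e # acc else acc) [] ys) \<le> poly p (esize x)"
      using esize_filter_le[of "P x" ys] by (simp add: fold)
  next
    have "poly_time (\<lambda>z :: 'a \<times> 'b list \<times> 'b. (fst z, snd (snd z)))"
      by (intro poly_time_pair poly_time_fst poly_time_snd poly_time_id)
    from poly_time_comp[OF P this]
    show "poly_time (\<lambda>z. if P (fst z) (snd (snd z)) then snd (snd z) # fst (snd z) else fst (snd z))"
      by (intro poly_time_if poly_time_Cons poly_time_fst poly_time_snd poly_time_id) simp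
  qed (intro xs poly_time_const)+
  from poly_time_rev[OF this] show ?thesis by (simp only: fold rev_rev_ident)
qed

lemma poly_time_member:
  fixes v :: "'a::encodable \<Rightarrow> 'b::encodable"
  assumes "poly_time v" "poly_time xs"
  shows "poly_time (\<lambda>x. v x \<in> set (xs x))"
proof -
  have fold: "foldl (\<lambda>acc e. acc \<or> e = v) False ys \<longleftrightarrow> v \<in> set ys" for v :: 'b and ys
    by (induction ys rule: rev_induct) auto
  have "poly_time (\<lambda>z :: 'b \<times> 'b list. foldl (\<lambda>acc e. acc \<or> e = fst z) False (snd z))"
  proof (rule poly_time_foldl)
    show "esize (foldl (\<lambda>acc e. acc \<or> e = fst z) False ys) \<le> poly 1 (esize z)"
      for z :: "'b \<times> 'b list" and ys by (simp add: encode_bool_def)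
  qed (intro poly_time_const poly_time_disj poly_time_eq poly_time_fst poly_time_snd poly_time_id)+
  from poly_time_comp[OF this poly_time_pair[OF assms]] show ?thesis by (simp add: fold)
qed

lemmas poly_time_intros =
  poly_time_const poly_time_id poly_time_pair poly_time_fst poly_time_snd poly_time_eq poly_time_if
  poly_time_not poly_time_conj poly_time_disj poly_time_member poly_time_map poly_time_filter

section \<open>The algorithm\<close>

text \<open>
  An association list \<open>m\<close> represents a map that sends each vertex to the label of its class.
  Merging replaces a label in the whole list, so one pass over the arcs finds the components.
\<close>

definition rep :: "('a \<times> 'a) list \<Rightarrow> 'a \<Rightarrow> 'a" where
  "rep m v = foldl (\<lambda>r e. if fst e = v then snd e else r) v m"

definition merge :: "('a \<times> 'a) list \<Rightarrow> 'a \<Rightarrow> 'a \<Rightarrow> ('a \<times> 'a) list" where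
  "merge m a b = map (\<lambda>e. (fst e, if snd e = rep m b then rep m a else snd e)) m"

definition labels :: "'a list \<Rightarrow> 'a list \<Rightarrow> ('a \<times> 'a) list \<Rightarrow> ('a \<times> 'a) list" where
  "labels vs is as = foldl
     (\<lambda>m e. if fst e \<in> set is \<and> snd e \<in> set is then merge m (fst e) (snd e) else m)
     (map (\<lambda>v. (v, v)) vs) as"

definition dominated :: "('a \<times> 'a) list \<Rightarrow> 'a list \<Rightarrow> 'a list \<Rightarrow> 'a list" where
  "dominated as is os = map fst (filter (\<lambda>e. fst e \<in> set os \<and> snd e \<in> set is) as)"

text \<open>The lists follow the order of \<open>encodes_instance\<close>, and the last
  \<open>()\<close> supplies the closing \<open>Leaf\<close>, so the result is again an encoded
  instance.\<close>

definition reduce where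
  "reduce vs as ls hs rs is os =
    (let f = rep (labels vs is as); D = dominated as is os; keep = filter (\<lambda>v. v \<notin> set D) in
      (keep (map f vs),
       map (\<lambda>e. (f (fst e), f (snd e)))
         (filter (\<lambda>e. (fst e \<in> set ls \<or> snd e \<in> set ls) \<and> fst e \<notin> set D \<and> snd e \<notin> set D) as),
       ls, keep (map f hs), filter (\<lambda>v. v \<notin> set (map f hs)) (keep (map f rs)),
       map f is, keep os, ()))"

section \<open>Running time of the reduction\<close>

lemma rep_cases: "rep m v = v \<or> rep m v \<in> snd ` set m"
  unfolding rep_def by (induction m rule: rev_induct) auto

lemma poly_time_rep:
  fixes v :: "'a::encodable \<Rightarrow> 'b::encodable"
  assumes "poly_time m" "poly_time v"
  shows "poly_time (\<lambda>x. rep (m x) (v x))"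
proof -
  have "poly_time (\<lambda>z :: ('b \<times> 'b) list \<times> 'b. rep (fst z) (snd z))"
    unfolding rep_def
  proof (rule poly_time_foldl)
    fix z :: "('b \<times> 'b) list \<times> 'b" and ys zs assume "fst z = ys @ zs"
    then have "esize ys + esize (snd z) \<le> esize z"
      by (simp add: encode_prod_def esize_append)
    moreover have "esize (rep ys (snd z)) \<le> esize ys + esize (snd z)"
      using rep_cases[of ys "snd z"] esize_mem[of _ ys] by (fastforce simp: encode_prod_def)
    ultimately show "esize (foldl (\<lambda>r e. if fst e = snd z then snd e else r) (snd z) ys)
        \<le> poly [:0, 1:] (esize z)"
      by (simp add: rep_def)
  qed (intro poly_time_intros)+
  from poly_time_comp[OF this poly_time_pair[OF assms]] show ?thesis by simp
qed

text \<open>Merging preserves the length of the list and, by \<open>rep_cases\<close>, only copies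
  existing labels or an end of an arc. All components of entries thus stay within the input size,
  and the accumulator is quadratically bounded.\<close>

lemma poly_time_labels:
  fixes vs :: "'a::encodable \<Rightarrow> 'b::encodable list"
  assumes "poly_time vs" "poly_time is" "poly_time as"
  shows "poly_time (\<lambda>x. labels (vs x) (is x) (as x))"
proof -
  let ?step = "\<lambda>is m e. if fst e \<in> set is \<and> snd e \<in> set is then merge m (fst e) (snd e) else m"
  have "poly_time (\<lambda>z :: 'b list \<times> 'b list \<times> ('b \<times> 'b) list. labels (fst z) (fst (snd z)) (snd (snd z)))"
    unfolding labels_def
  proof (rule poly_time_foldl)
    fix z :: "'b list \<times> 'b list \<times> ('b \<times> 'b) list" and ys zs
    assume eq: "snd (snd z) = ys @ zs"
    let ?n = "esize z" and ?m = "foldl (?step (fst (snd z))) (map (\<lambda>v. (v, v)) (fst z)) ys"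
    have vs: "esize (fst z) \<le> ?n" and as: "esize (snd (snd z)) \<le> ?n"
      by (simp_all add: encode_prod_def)
    have "length ?m = length (fst z) \<and> (\<forall>e\<in>set ?m. esize (fst e) \<le> ?n \<and> esize (snd e) \<le> ?n)"
    proof -
      \<comment> \<open>First ends suffice, since \<open>merge\<close> writes the label of its first
        vertex.\<close>
      have "\<forall>e\<in>set ys. esize (fst e) \<le> ?n"
      proof
        fix e assume "e \<in> set ys"
        then show "esize (fst e) \<le> ?n"
          using esize_mem[of e "snd (snd z)"] as eq by (simp add: encode_prod_def)
      qed
      then show ?thesis
      proof (induction ys rule: rev_induct)
        case Nil
        then show ?case using vs by (auto dest: esize_mem)
      next
        case (snoc e ys)
        let ?m = "foldl (?step (fst (snd z))) (map (\<lambda>v. (v, v)) (fst z)) ys"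
        have IH: "length ?m = length (fst z)" "\<forall>e\<in>set ?m. esize (fst e) \<le> ?n \<and> esize (snd e) \<le> ?n"
          using snoc by auto
        then have "esize (rep ?m (fst e)) \<le> ?n"
          using rep_cases[of ?m "fst e"] snoc.prems by auto
        with IH show ?case by (simp add: merge_def)
      qed
    qed
    then have "esize ?m \<le> length (fst z) * (2 * ?n + 1 + 1)"
      using esize_list_le[of ?m "2 * ?n + 1"] by (fastforce simp: encode_prod_def)
    also have "\<dots> \<le> ?n * (2 * ?n + 1 + 1)"
      using length_le_esize[of "fst z"] vs by (intro mult_right_mono) auto
    finally show "esize ?m \<le> poly [:0, 2, 2:] ?n"
      by (simp add: algebra_simps)
  qed ((unfold merge_def)?, intro poly_time_intros poly_time_rep)+
  from poly_time_comp[OF this poly_time_pair[OF assms(1) poly_time_pair[OF assms(2,3)]]]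
  show ?thesis by simp
qed

lemma poly_time_reduce:
  "poly_time (\<lambda>(vs, as, ls, hs, rs, is, os, u :: unit). reduce vs as ls hs rs is (os :: 'a::encodable list))"
  unfolding reduce_def Let_def dominated_def split_def
  by (intro poly_time_intros poly_time_rep poly_time_labels)

section \<open>Correctness of the component labels\<close>

lemma rep_map: "rep (map (\<lambda>v. (v, g v)) vs) v = (if v \<in> set vs then g v else v)"
  unfolding rep_def by (induction vs rule: rev_induct) auto

text \<open>The full arc set \<open>A\<close> is kept apart from the processed prefix
  \<open>as\<close>: a prefix need not be symmetric, so paths to labels are taken in
  \<open>A\<close>, whereas equal labels are claimed only along processed arcs.\<close>

lemma labels_invariant:
  assumes "set is \<subseteq> set vs" "sym A" "set as \<subseteq> A"
  shows "\<exists>g. labels vs is as = map (\<lambda>v. (v, g v)) vs \<and> (\<forall>v. v \<notin> set is \<longrightarrow> g v = v) \<and>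
    (\<forall>v\<in>set is. g v \<in> set is \<and> (v, g v) \<in> (A \<inter> set is \<times> set is)\<^sup>*) \<and>
    (\<forall>(a, b)\<in>set as. a \<in> set is \<longrightarrow> b \<in> set is \<longrightarrow> g a = g b)"
  using assms(3)
proof (induction as rule: rev_induct)
  case Nil
  then show ?case by (intro exI[of _ "\<lambda>v. v"]) (simp add: labels_def)
next
  case (snoc e as)
  let ?I = "set is" and ?E = "A \<inter> set is \<times> set is"
  obtain g where eq: "labels vs is as = map (\<lambda>v. (v, g v)) vs" and out: "\<forall>v. v \<notin> ?I \<longrightarrow> g v = v"
    and mem: "\<forall>v\<in>?I. g v \<in> ?I" and path: "\<forall>v\<in>?I. (v, g v) \<in> ?E\<^sup>*"
    and arc: "\<forall>(a, b)\<in>set as. a \<in> ?I \<longrightarrow> b \<in> ?I \<longrightarrow> g a = g b"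
    using snoc by auto
  obtain a b where e: "e = (a, b)" by (cases e)
  show ?case
  proof (cases "a \<in> ?I \<and> b \<in> ?I")
    case False
    then have "labels vs is (as @ [e]) = labels vs is as" by (auto simp: labels_def e)
    then show ?thesis
      using eq out mem path arc False by (intro exI[of _ g]) (auto simp: e)
  next
    case True
    define g' where "g' v = (if g v = g b then g a else g v)" for v
    have "labels vs is (as @ [e]) = merge (labels vs is as) a b"
      using True by (simp add: labels_def e)
    also have "\<dots> = map (\<lambda>v. (v, g' v)) vs"
      using True assms(1) by (auto simp: merge_def eq rep_map g'_def)
    finally have "labels vs is (as @ [e]) = map (\<lambda>v. (v, g' v)) vs" .
    moreover have "\<forall>v. v \<notin> ?I \<longrightarrow> g' v = v"
      using out mem True by (auto simp: g'_def)
    moreover have "\<forall>v\<in>?I. g' v \<in> ?I" using mem True by (simp add: g'_def)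
    moreover have "(v, g' v) \<in> ?E\<^sup>*" if v: "v \<in> ?I" for v
    proof (cases "g v = g b")
      case eq: True
      have sym: "sym (?E\<^sup>*)"
        using assms(2) by (intro sym_rtrancl symI) (auto dest: symD)
      \<comment> \<open>The walk passes through \<open>v\<close>, \<open>g b\<close>,
        \<open>b\<close>, \<open>a\<close>, \<open>g a\<close>; the piece from \<open>g b\<close> to
        \<open>b\<close> is the path to the label of \<open>b\<close>, reversed.\<close>
      have "(v, g b) \<in> ?E\<^sup>*" using path v eq by metis
      moreover have "(g b, b) \<in> ?E\<^sup>*" using path True sym by (meson symD)
      moreover have "(b, a) \<in> ?E\<^sup>*" using snoc.prems True assms(2) by (auto simp: e dest: symD)
      moreover have "(a, g a) \<in> ?E\<^sup>*" using path True by blast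
      ultimately show ?thesis using eq by (simp add: g'_def)
    next
      case False
      then show ?thesis using path v by (simp add: g'_def)
    qed
    \<comment> \<open>\<open>g' v\<close> depends on \<open>v\<close> only through
      \<open>g v\<close>, so arcs settled earlier remain settled; for the new arc both values are
      \<open>g a\<close>.\<close>
    moreover have "\<forall>(c, d)\<in>set (as @ [e]). c \<in> ?I \<longrightarrow> d \<in> ?I \<longrightarrow> g' c = g' d"
      using arc by (auto simp: g'_def e)
    ultimately show ?thesis by (intro exI[of _ g']) auto
  qed
qed

lemma contraction_labels:
  assumes "pair_graph G" "good_partition l G L H R" "bipartition_of (H \<union> R) (set is) Out"
    and "set vs = pverts G" "set as = parcs G"
  shows "contraction l G L H R (set is) Out (rep (labels vs is as))"
proof -
  have I: "set is \<subseteq> set vs"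
    using assms by (auto simp: bipartition_of_def good_partition_def tripartition_of_def)
  have "sym (set as)"
    using pair_sym_digraph.arcs_symmetric[OF pair_pseudo_graph.axioms(2)[OF pair_graph.axioms(2)[OF assms(1)]]]
    by (auto simp: assms(5) intro: symI)
  from labels_invariant[OF I this subset_refl] obtain g where
    eq: "labels vs is as = map (\<lambda>v. (v, g v)) vs" and out: "\<forall>v. v \<notin> set is \<longrightarrow> g v = v"
    and mem: "\<forall>v\<in>set is. g v \<in> set is \<and> (v, g v) \<in> (set as \<inter> set is \<times> set is)\<^sup>*"
    and arc: "\<forall>(a, b)\<in>set as. a \<in> set is \<longrightarrow> b \<in> set is \<longrightarrow> g a = g b"
    by (elim exE conjE) (rule that)
  \<comment> \<open>Outside \<open>vs\<close>, \<open>rep\<close> returns its default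
    \<open>v\<close>, and \<open>g\<close> fixes \<open>v\<close> because
    \<open>set is \<subseteq> set vs\<close>.\<close>
  have "rep (labels vs is as) = g"
    using out I by (auto simp: eq rep_map fun_eq_iff)
  with assms out mem arc show ?thesis
    by (auto simp: contraction_def)
qed

section \<open>Encoded instances and correctness of the reduction\<close>

lemma encodes_instance_iff:
  "encodes_instance x G L H R In Out \<longleftrightarrow>
    (\<exists>vs as ls hs rs is os. set vs = pverts G \<and> set as = parcs G \<and> set ls = L \<and> set hs = H \<and>
      set rs = R \<and> set is = In \<and> set os = Out \<and> x = encode (vs, as, ls, hs, rs, is, os, ()))"
proof -
  have "enc_arc = encode"
    by (simp add: fun_eq_iff enc_arc_def encode_prod_def encode_nat_def)
  moreover have "enc_nat = encode" by (simp add: encode_nat_def)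
  moreover have "Leaf = encode ()" by (simp add: encode_unit_def)
  ultimately show ?thesis
    by (simp add: encodes_instance_def flip: encode_list_def)
qed

lemma encodes_instanceI:
  assumes "set vs = pverts G" "set as = parcs G" "set ls = L" "set hs = H" "set rs = R"
    "set is = In" "set os = Out"
  shows "encodes_instance (encode (vs, as, ls, hs, rs, is, os, ())) G L H R In Out"
  using assms by (auto simp: encodes_instance_iff simp del: encode_Pair)

text \<open>The computed lists enumerate the sets of the abstract contraction with \<open>f\<close>
  taken to be the label map, so the graph-theoretic claims are those of the locale.\<close>

lemma reduce_correct:
  assumes G: "pair_graph G" "good_partition l G L H R" "bipartition_of (H \<union> R) In Out"
    and sets: "set vs = pverts G" "set as = parcs G" "set ls = L" "set hs = H" "set rs = R"
      "set is = In" "set os = Out"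
  shows "\<exists>G' H' R' In' Out'.
    encodes_instance (encode (reduce vs as ls hs rs is os)) G' L H' R' In' Out' \<and>
    pair_graph G' \<and> L \<subseteq> pverts G \<inter> pverts G' \<and>
    excellent_partition l G' L H' R' \<and> bipartition_of (H' \<union> R') In' Out' \<and>
    (\<forall>S. S \<subseteq> L \<longrightarrow> minimal_extension G In Out S = minimal_extension G' In' Out' S)"
proof -
  let ?f = "rep (labels vs is as)"
  interpret contraction l G L H R In Out ?f
    using contraction_labels[OF G(1,2) G(3)[folded sets(6)] sets(1,2)] by (simp only: sets(6))
  have D: "set (dominated as is os) = D"
    by (force simp: dominated_def D_def sets)
  have "encodes_instance (encode (reduce vs as ls hs rs is os)) G' L (?f ` H - D) (?f ` R - D - ?f ` H)
      (?f ` In) (Out - D)"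
    unfolding reduce_def Let_def
  proof (rule encodes_instanceI)
    show "set (map (\<lambda>e. (?f (fst e), ?f (snd e))) (filter (\<lambda>e. (fst e \<in> set ls \<or> snd e \<in> set ls) \<and>
        fst e \<notin> set (dominated as is os) \<and> snd e \<notin> set (dominated as is os)) as)) = parcs G'"
      unfolding D by (auto simp: G'_def sets map_prod_def split_def image_iff)
  qed (auto simp: G'_def sets D)
  moreover have "L \<subseteq> pverts G \<inter> pverts G'"
    using parts(1) excellent_G'
    by (auto simp: excellent_partition_def good_partition_def tripartition_of_def)
  ultimately show ?thesis
    using pair_graph_G' excellent_G' bipartition_G' minimal_extension_iff by blast
qed

theorem lemma13:
  fixes l :: nat
  assumes "l \<ge> 1"
  shows "\<exists>(P :: com) (p :: nat poly).
    \<forall>(G :: nat pair_pre_digraph) L H R In Out x.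
      pair_graph G \<and> good_partition l G L H R \<and> bipartition_of (H \<union> R) In Out \<and>
      encodes_instance x G L H R In Out \<longrightarrow>
      (\<exists>t y G' H' R' In' Out'.
        computes P x t y \<and> t \<le> poly p (size x) \<and>
        encodes_instance y G' L H' R' In' Out' \<and>
        pair_graph G' \<and> L \<subseteq> pverts G \<inter> pverts G' \<and>
        excellent_partition l G' L H' R' \<and> bipartition_of (H' \<union> R') In' Out' \<and>
        (\<forall>S. S \<subseteq> L \<longrightarrow> minimal_extension G In Out S = minimal_extension G' In' Out' S))"
proof -
  let ?alg = "\<lambda>(vs, as, ls, hs, rs, is, os, u :: unit). reduce vs as ls hs rs is (os :: nat list)"
  have "poly_time ?alg"
    by (rule poly_time_reduce)
  \<comment> \<open>Program and polynomial are fixed before any instance is, as the quantifier order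
    of the statement demands.\<close>
  then obtain P N p where P: "realizes P N p ?alg"
    by (rule poly_timeE)
  show ?thesis
  proof (intro exI[of _ P] exI[of _ p] allI impI, elim conjE)
    fix G :: "nat pair_pre_digraph" and L H R In Out x
    assume G: "pair_graph G" "good_partition l G L H R" "bipartition_of (H \<union> R) In Out"
      and "encodes_instance x G L H R In Out"
    then obtain vs as ls hs rs "is" os where sets: "set vs = pverts G" "set as = parcs G"
      "set ls = L" "set hs = H" "set rs = R" "set is = In" "set os = Out"
      and x: "x = encode (vs, as, ls, hs, rs, is, os, ())"
      unfolding encodes_instance_iff by (elim exE conjE) (rule that)
    have x0: "((\<lambda>_. Leaf)(0 := x)) 0 = encode (vs, as, ls, hs, rs, is, os, ())"
      by (simp add: x)
    obtain t s where t: "exec P ((\<lambda>_. Leaf)(0 := x)) t s" "t \<le> poly p (size x)"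
      and s: "s 0 = encode (?alg (vs, as, ls, hs, rs, is, os, ()))"
      by (rule realizesE[where s = "(\<lambda>_. Leaf)(0 := x)", OF P x0]) (use x in blast)
    have "s 0 = encode (reduce vs as ls hs rs is os)"
      using s by (simp only: prod.case)
    then have "computes P x t (encode (reduce vs as ls hs rs is os))"
      using t(1) by (auto simp: computes_def)
    then show "\<exists>t y G' H' R' In' Out'.
        computes P x t y \<and> t \<le> poly p (size x) \<and>
        encodes_instance y G' L H' R' In' Out' \<and>
        pair_graph G' \<and> L \<subseteq> pverts G \<inter> pverts G' \<and>
        excellent_partition l G' L H' R' \<and> bipartition_of (H' \<union> R') In' Out' \<and>
        (\<forall>S. S \<subseteq> L \<longrightarrow> minimal_extension G In Out S = minimal_extension G' In' Out' S)"
      using t(2) reduce_correct[OF G sets] by (elim exE conjE) (intro exI conjI, assumption+)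
  qed
qed

end
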